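(* Let $c_1,c_2,c_3$ be real constants, not all zero, and let $u:\mathbb R\to(0,\infty)$ be a positive solution (on the whole line) of the ordinary differential equation $$u_{\theta\theta}+\frac{1}{2u^{5}}\left(-c_1+c_2\cos\theta+c_3\sin\theta\right)+\frac u4=0 .$$ Then: (i) If $-c_1^2+c_2^2+c_3^2<0$, there exist two positive constants $D_1,D_2$ such that $D_1\le u(\theta)\le D_2$ for all $\theta$. (ii) If $-c_1^2+c_2^2+c_3^2\ge 0$, then $u$ is unbounded and its infimum is $0$. (iii) If $-c_1^2+c_2^2+c_3^2=0$, there exists a fixed point $u(\theta_0)=u(\theta_0+2\pi)$, where $\theta_0$ satisfies $c_1\cos\theta_0=c_2$ and $c_1\sin\theta_0=c_3$. *)

theory Defs
  imports "HOL-Analysis.Analysis"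
begin

text \<open>
  Solutions are classical: \<open>u\<close> is twice differentiable on the whole line.  The equation then makes
  the second derivative continuous, so requiring \<open>C\<^sup>2\<close> would describe the same functions.
\<close>

definition positive_solution :: "real \<Rightarrow> real \<Rightarrow> real \<Rightarrow> (real \<Rightarrow> real) \<Rightarrow> bool" where
  "positive_solution c1 c2 c3 u \<longleftrightarrow>
     (\<forall>\<theta>. u \<theta> > 0) \<and>
     (\<forall>\<theta>. u differentiable (at \<theta>)) \<and>
     (\<forall>\<theta>. deriv u differentiable (at \<theta>)) \<and>
     (\<forall>\<theta>. deriv (deriv u) \<theta>
           + 1 / (2 * u \<theta> ^ 5) * (- c1 + c2 * cos \<theta> + c3 * sin \<theta>) + u \<theta> / 4 = 0)"

end

theory Submission
  imports Defs
begin

text \<open>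
  A rotation brings the equation into the form \<open>u'' + u/4 = f/(2u\<^sup>5)\<close> with \<open>f(t) = c - R cos t\<close>,
  \<open>R \<ge> 0\<close>, for which
  \<open>J = f u'\<^sup>2 - f' u u' + (f/4 + f''/2) u\<^sup>2 + f\<^sup>2/(4u\<^sup>4)\<close> is conserved.

  If \<open>R\<^sup>2 < c\<^sup>2\<close>, then \<open>f > 0\<close> (for \<open>f < 0\<close> the function \<open>u\<close> would be concave), and \<open>f J\<close> is a
  square plus \<open>(c\<^sup>2 - R\<^sup>2)u\<^sup>2/4 + f\<^sup>3/(4u\<^sup>4)\<close>, which bounds \<open>u\<close> from both sides.

  If \<open>R\<^sup>2 > c\<^sup>2\<close>, let \<open>a, b, a'\<close> be the values of \<open>u\<close> at the consecutive zeros \<open>-\<alpha>, \<alpha>, 2\<pi> - \<alpha>\<close> of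
  \<open>f\<close>.  Sturm comparison with solutions of \<open>w'' + w/4 = 0\<close> gives \<open>R a b/2 < J\<close> on the arc where
  \<open>f < 0\<close>, and comparison for \<open>U = u\<^sup>2\<close>, which satisfies \<open>f U'' - f' U' + c U = 2J + f\<^sup>2/(2U\<^sup>2)\<close>,
  gives \<open>J \<le> R b a'/2\<close> on the arc where \<open>f > 0\<close>.  Hence the values \<open>u(2\<pi>k - \<alpha>)\<close> increase with \<open>k\<close>;
  a quantitative form of the first inequality makes the growth geometric as long as \<open>u\<close> stays
  bounded.  A positive lower bound for \<open>u\<close> would bound \<open>a \<le> 2J/(R b)\<close> and thereby \<open>u\<close> on all
  arcs with \<open>f < 0\<close>.

  If \<open>R\<^sup>2 = c\<^sup>2\<close>, then \<open>f\<close> has only double zeros, \<open>J\<close> fixes the value \<open>u\<^sub>0\<close> of \<open>u\<close> there, and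
  \<open>Z = U - u\<^sub>0\<^sup>2\<close> satisfies \<open>(Z' - cot(t/2) Z)' = f/(2u\<^sup>4)\<close>.  Over one period \<open>2 u\<^sub>0 u'\<close> thus drops by
  \<open>\<integral> f/(2u\<^sup>4)\<close>, and a steep slope at a zero of
  \<open>f\<close> is incompatible with either bound on \<open>u\<close>.
\<close>

section \<open>Calculus preliminaries\<close>

lemma taylor_order_two:
  fixes f g h :: "real \<Rightarrow> real"
  assumes f: "\<And>t. (f has_real_derivative g t) (at t)"
    and g: "\<And>t. (g has_real_derivative h t) (at t)"
  shows "\<exists>\<xi>. min s t \<le> \<xi> \<and> \<xi> \<le> max s t \<and>
           f t = f s + g s * (t - s) + h \<xi> / 2 * (t - s)\<^sup>2"
proof (cases "s = t")
  case False
  define d where "d = (\<lambda>n::nat. if n = 0 then f else if n = 1 then g else h)"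
  have "\<exists>\<xi>. (if t < s then t < \<xi> \<and> \<xi> < s else s < \<xi> \<and> \<xi> < t) \<and>
      f t = (\<Sum>m<2. (d m s / fact m) * (t - s)^m) + (d 2 \<xi> / fact 2) * (t - s)^2"
    by (rule Taylor[where a = "min s t" and b = "max s t"])
      (use False f g in \<open>auto simp: d_def less_2_cases_iff\<close>)
  then obtain \<xi> where "if t < s then t < \<xi> \<and> \<xi> < s else s < \<xi> \<and> \<xi> < t"
      "f t = f s + g s * (t - s) + h \<xi> / 2 * (t - s)\<^sup>2"
    by (auto simp: d_def numeral_2_eq_2)
  then show ?thesis
    by (intro exI[of _ \<xi>]) (auto split: if_splits)
qed (auto intro: exI[of _ t])

text \<open>Dividing both functions by \<open>x - a\<close> leaves two difference quotients, so
  derivatives at the single point \<open>a\<close> suffice. This evaluates the comparison quotients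
  at zeros of the coefficient.\<close>

lemma tendsto_quotient_at_common_zero:
  fixes B S :: "real \<Rightarrow> real"
  assumes B: "(B has_real_derivative B') (at a)" "B a = 0"
    and S: "(S has_real_derivative S') (at a)" "S a = 0" "S' \<noteq> 0"
  shows "((\<lambda>x. B x / S x) \<longlongrightarrow> B' / S') (at a)"
proof -
  have "((\<lambda>x. ((B x - B a) / (x - a)) / ((S x - S a) / (x - a))) \<longlongrightarrow> B' / S') (at a)"
    using B(1) S(1,3) by (intro tendsto_divide) (auto simp: has_field_derivative_iff)
  then show ?thesis
    by (rule Lim_transform_eventually)
      (use B(2) S(2) in \<open>auto simp: eventually_at_filter\<close>)
qed

lemma quotient_nondecreasing:
  fixes B S :: "real \<Rightarrow> real"
  assumes "x \<le> y"
    and B: "\<And>t. (B has_real_derivative B' t) (at t)"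
    and S: "\<And>t. (S has_real_derivative S' t) (at t)"
    and nz: "\<And>t. x \<le> t \<Longrightarrow> t \<le> y \<Longrightarrow> S t \<noteq> 0"
    and nonneg: "\<And>t. x \<le> t \<Longrightarrow> t \<le> y \<Longrightarrow> 0 \<le> B' t * S t - B t * S' t"
  shows "B x / S x \<le> B y / S y"
proof (rule DERIV_nonneg_imp_nondecreasing[OF \<open>x \<le> y\<close>])
  fix t assume t: "x \<le> t" "t \<le> y"
  have "((\<lambda>t. B t / S t) has_real_derivative (B' t * S t - B t * S' t) / (S t * S t)) (at t)"
    using nz[OF t] by (intro DERIV_divide B S)
  then show "\<exists>D. ((\<lambda>t. B t / S t) has_real_derivative D) (at t) \<and> 0 \<le> D"
    using nonneg[OF t] by (meson divide_nonneg_nonneg zero_le_square)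
qed

subsection \<open>The conserved quantity\<close>

locale rotated_solution =
  fixes c R :: real and u v :: "real \<Rightarrow> real"
  assumes R_nonneg: "0 \<le> R"
    and u_pos: "0 < u t"
    and u_deriv: "(u has_real_derivative v t) (at t)"
    and v_deriv: "(v has_real_derivative (c - R * cos t) / (2 * u t ^ 5) - u t / 4) (at t)"
begin

text \<open>Here \<open>f' = R sin t\<close> and \<open>f'' = R cos t\<close>, so
  \<open>f/4 + f''/2\<close> collapses to \<open>c/4 + R cos t/4\<close>.\<close>

definition energy :: "real \<Rightarrow> real" where
  "energy t = (c - R * cos t) * (v t)\<^sup>2 - R * sin t * u t * v t
     + (c / 4 + R * cos t / 4) * (u t)\<^sup>2 + (c - R * cos t)\<^sup>2 / (4 * u t ^ 4)"

lemma energy_constant: "energy s = energy t"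
proof -
  have "(energy has_real_derivative 0) (at t)" for t
  proof -
    have nz: "u t \<noteq> 0" using u_pos[of t] by simp
    show ?thesis
      unfolding energy_def
      apply (rule derivative_eq_intros u_deriv v_deriv refl | simp add: nz)+
      using nz by (simp add: field_simps power2_eq_square) (simp add: eval_nat_numeral)
  qed
  then show ?thesis by (rule DERIV_isconst_all[OF allI])
qed

text \<open>Complete the square in \<open>v\<close>: what is left in front of \<open>u^2\<close>,
  namely \<open>f (f/4 + f''/2) - f'^2/4\<close>, is constant in \<open>t\<close>.\<close>

lemma energy_square:
  "(c - R * cos t) * energy t =
     ((c - R * cos t) * v t - R * sin t * u t / 2)\<^sup>2 + (c\<^sup>2 - R\<^sup>2) * (u t)\<^sup>2 / 4
     + (c - R * cos t) ^ 3 / (4 * u t ^ 4)"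
proof -
  have poly: "(c - R * x) * ((c - R * x) * q\<^sup>2 - R * y * p * q + (c / 4 + R * x / 4) * p\<^sup>2) =
      ((c - R * x) * q - R * y * p / 2)\<^sup>2 + (c\<^sup>2 - R\<^sup>2) * p\<^sup>2 / 4
      + R\<^sup>2 * p\<^sup>2 / 4 * (1 - (y\<^sup>2 + x\<^sup>2))" for x y p q :: real
    by (simp add: field_simps power2_eq_square)
  have "(c - R * cos t) * ((c - R * cos t) * (v t)\<^sup>2 - R * sin t * u t * v t
      + (c / 4 + R * cos t / 4) * (u t)\<^sup>2) =
      ((c - R * cos t) * v t - R * sin t * u t / 2)\<^sup>2 + (c\<^sup>2 - R\<^sup>2) * (u t)\<^sup>2 / 4"
    using poly[of "cos t" "v t" "sin t" "u t"] by simp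
  moreover have "(c - R * cos t) * ((c - R * cos t)\<^sup>2 / (4 * u t ^ 4)) = (c - R * cos t) ^ 3 / (4 * u t ^ 4)"
    by (simp add: power3_eq_cube power2_eq_square)
  ultimately show ?thesis
    unfolding energy_def distrib_left[of _ _ "_ / _"] by linarith
qed

definition sq_deriv2 :: "real \<Rightarrow> real" where
  "sq_deriv2 t = 2 * (v t)\<^sup>2 - (u t)\<^sup>2 / 2 + (c - R * cos t) / u t ^ 4"

lemma sq_deriv: "((\<lambda>t. (u t)\<^sup>2) has_real_derivative 2 * u t * v t) (at t)"
  by (rule derivative_eq_intros u_deriv refl | simp)+

lemma uv_deriv: "((\<lambda>t. 2 * u t * v t) has_real_derivative sq_deriv2 t) (at t)"
proof -
  have nz: "u t \<noteq> 0" using u_pos[of t] by simp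
  show ?thesis
    unfolding sq_deriv2_def
    apply (rule derivative_eq_intros u_deriv v_deriv refl | simp add: nz)+
    using nz by (simp add: field_simps power2_eq_square) (simp add: eval_nat_numeral)
qed

text \<open>Eliminating \<open>v^2\<close> between the energy and \<open>U''\<close> gives an
  equation for \<open>U = u^2\<close> that is linear up to a nonnegative source. Hence the later
  comparisons use \<open>U\<close> instead of \<open>u\<close>.\<close>

lemma sq_equation:
  "(c - R * cos t) * sq_deriv2 t - R * sin t * (2 * u t * v t) + c * (u t)\<^sup>2
     = 2 * energy t + (c - R * cos t)\<^sup>2 / (2 * u t ^ 4)"
proof -
  have nz: "u t \<noteq> 0" using u_pos[of t] by simp
  show ?thesis unfolding energy_def sq_deriv2_def
    using nz by (simp add: field_simps power2_eq_square)
qed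

lemma second_order_expansion:
  "\<exists>\<xi>. min s t \<le> \<xi> \<and> \<xi> \<le> max s t \<and>
     u t = u s + v s * (t - s) + ((c - R * cos \<xi>) / (2 * u \<xi> ^ 5) - u \<xi> / 4) / 2 * (t - s)\<^sup>2"
  by (rule taylor_order_two) (rule u_deriv v_deriv)+

lemma shift:
  assumes "\<And>t. cos (t + p) = cos t"
  shows "rotated_solution c R (\<lambda>t. u (t + p)) (\<lambda>t. v (t + p))"
proof
  fix t
  show "((\<lambda>t. u (t + p)) has_real_derivative v (t + p)) (at t)"
    using DERIV_shift u_deriv by blast
  show "((\<lambda>t. v (t + p)) has_real_derivative
      (c - R * cos t) / (2 * u (t + p) ^ 5) - u (t + p) / 4) (at t)"
    using v_deriv[of "t + p"] assms DERIV_shift by metis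
qed (use R_nonneg u_pos in auto)

text \<open>Interpreting the locale for the shifted solution carries results about one period over
  to every later period.\<close>

lemma shift_periods:
  "rotated_solution c R (\<lambda>t. u (t + real k * (2 * pi))) (\<lambda>t. v (t + real k * (2 * pi)))"
  by (rule shift) (use cos.plus_of_nat[where 'a = real] in simp)

lemma coefficient_bounds: "c - R \<le> c - R * cos t" "c - R * cos t \<le> c + R"
proof -
  have "R * cos t \<le> R * 1" "R * (- 1) \<le> R * cos t"
    using R_nonneg by (rule mult_left_mono[rotated]; simp)+
  then show "c - R \<le> c - R * cos t" "c - R * cos t \<le> c + R" by auto
qed

text \<open>Otherwise \<open>u\<close> would be strictly concave and positive on the whole line.\<close>
lemma coefficient_not_nonpositive: "- R < c"
proof (rule ccontr)
  assume "\<not> - R < c"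
  then have f: "c - R * cos t \<le> 0" for t using coefficient_bounds(2)[of t] by linarith
  have neg: "(c - R * cos t) / (2 * u t ^ 5) - u t / 4 < 0" for t
  proof -
    have "(c - R * cos t) / (2 * u t ^ 5) \<le> 0"
      using f[of t] u_pos[of t] by (intro divide_nonpos_pos) auto
    then show ?thesis using u_pos[of t] by linarith
  qed
  have "v 1 < v 0"
    using v_deriv neg by (intro DERIV_neg_imp_decreasing[of 0 1 v]) (blast | simp)+
  then obtain s where s: "v s \<noteq> 0" by (metis less_irrefl)
  \<comment> \<open>The tangent at \<open>s\<close> vanishes at \<open>s - u s / v s\<close>, and
    concavity keeps \<open>u\<close> below it.\<close>
  obtain \<xi> where "u (s - u s / v s) = u s + v s * ((s - u s / v s) - s)
      + ((c - R * cos \<xi>) / (2 * u \<xi> ^ 5) - u \<xi> / 4) / 2 * ((s - u s / v s) - s)\<^sup>2"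
    using second_order_expansion[of s "s - u s / v s"] by blast
  moreover have "((c - R * cos \<xi>) / (2 * u \<xi> ^ 5) - u \<xi> / 4) / 2 * ((s - u s / v s) - s)\<^sup>2 \<le> 0"
    by (rule mult_nonpos_nonneg) (use neg[of \<xi>] in auto)
  moreover have "v s * ((s - u s / v s) - s) = - u s" using s by simp
  ultimately show False using u_pos[of "s - u s / v s"] by linarith
qed

lemma bounded_away_if_definite:
  assumes "R\<^sup>2 < c\<^sup>2"
  shows "\<exists>D1 D2. 0 < D1 \<and> 0 < D2 \<and> (\<forall>t. D1 \<le> u t \<and> u t \<le> D2)"
proof -
  have cR: "R < c"
    using assms coefficient_not_nonpositive R_nonneg abs_le_square_iff[of c R] by linarith
  define K where "K = (c + R) * \<bar>energy 0\<bar>"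
  have bd: "(c\<^sup>2 - R\<^sup>2) * (u t)\<^sup>2 / 4 + (c - R) ^ 3 / (4 * u t ^ 4) \<le> K" for t
  proof -
    have "(c - R * cos t) * energy t \<le> K"
    proof -
      have "(c - R * cos t) * energy t \<le> (c - R * cos t) * \<bar>energy t\<bar>"
        using coefficient_bounds[of t] cR by (intro mult_left_mono) auto
      also have "\<dots> \<le> (c + R) * \<bar>energy t\<bar>"
        using coefficient_bounds[of t] by (intro mult_right_mono) auto
      finally show ?thesis by (simp add: K_def energy_constant[of 0 t])
    qed
    moreover have "(c - R) ^ 3 / (4 * u t ^ 4) \<le> (c - R * cos t) ^ 3 / (4 * u t ^ 4)"
      using coefficient_bounds[of t] cR u_pos[of t] by (intro divide_right_mono power_mono) auto
    ultimately show ?thesis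
      using energy_square[of t] zero_le_power2[of "(c - R * cos t) * v t - R * sin t * u t / 2"]
      by linarith
  qed
  have p1: "0 \<le> (c\<^sup>2 - R\<^sup>2) * (u t)\<^sup>2 / 4" and p2: "0 < (c - R) ^ 3 / (4 * u t ^ 4)" for t
    using assms cR u_pos[of t] by auto
  have K: "0 < K" using bd[of 0] p1[of 0] p2[of 0] by linarith
  define y where "y = 4 * K / (c\<^sup>2 - R\<^sup>2)"
  define x where "x = (c - R) ^ 3 / (4 * K)"
  have x: "0 < x" using cR K by (simp add: x_def)
  \<comment> \<open>The bounds are really \<open>x \<le> u^4\<close> and \<open>u^2 \<le> y\<close>;
    comparing \<open>u\<close> with 1 avoids roots.\<close>
  have "min 1 x \<le> u t \<and> u t \<le> max 1 y" for t
  proof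
    have "(c - R) ^ 3 / (4 * u t ^ 4) \<le> K" using bd[of t] p1[of t] by linarith
    then have "x \<le> u t ^ 4"
      using u_pos[of t] K by (simp add: x_def field_simps)
    moreover have "u t ^ 4 \<le> u t" if "u t \<le> 1"
      using power_decreasing[of 1 4 "u t"] that u_pos[of t] by simp
    ultimately show "min 1 x \<le> u t" by linarith
    have "(c\<^sup>2 - R\<^sup>2) * (u t)\<^sup>2 / 4 \<le> K" using bd[of t] p2[of t] by linarith
    then have "(u t)\<^sup>2 \<le> y"
      using assms by (simp add: y_def field_simps)
    moreover have "u t \<le> (u t)\<^sup>2" if "1 \<le> u t"
      using power_increasing[of 1 2 "u t"] that by simp
    ultimately show "u t \<le> max 1 y" by linarith
  qed
  then show ?thesis using x by (intro exI[of _ "min 1 x"] exI[of _ "max 1 y"]) auto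
qed

end

subsection \<open>Simple zeros of the coefficient\<close>

locale oscillating_solution = rotated_solution +
  fixes \<alpha> :: real
  assumes \<alpha>: "0 < \<alpha>" "\<alpha> < pi" and R_pos: "0 < R" and c_eq: "c = R * cos \<alpha>"
begin

lemma sin_\<alpha>_pos: "0 < sin \<alpha>"
  using \<alpha> by (intro sin_gt_zero)

lemma oscillating_shift_periods:
  "oscillating_solution c R (\<lambda>t. u (t + real k * (2 * pi))) (\<lambda>t. v (t + real k * (2 * pi))) \<alpha>"
  using shift_periods[of k] \<alpha> R_pos c_eq
  by (simp add: oscillating_solution_def oscillating_solution_axioms_def)

lemma coefficient_nonpos: "c - R * cos t \<le> 0" if "\<bar>t\<bar> \<le> \<alpha>"
proof -
  have "cos \<alpha> \<le> cos \<bar>t\<bar>" using that \<alpha> by (intro cos_monotone_0_pi_le) auto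
  then show ?thesis using R_pos by (simp add: c_eq)
qed

section \<open>The arc from -\<alpha> to \<alpha>, where the coefficient is nonpositive\<close>

text \<open>Wronskian with the solution \<open>sin ((\<alpha> - t)/2)\<close> of the linear equation vanishing at \<open>\<alpha>\<close>.\<close>
definition wronskian :: "real \<Rightarrow> real" where
  "wronskian t = sin ((\<alpha> - t) / 2) * v t + cos ((\<alpha> - t) / 2) * u t / 2"

lemma wronskian_deriv:
  "(wronskian has_real_derivative sin ((\<alpha> - t) / 2) * (c - R * cos t) / (2 * u t ^ 5)) (at t)"
  unfolding wronskian_def
  apply (rule derivative_eq_intros u_deriv v_deriv refl | simp)+
  using u_pos[of t] by (simp add: field_simps)

text \<open>At a zero of the coefficient the energy loses its \<open>v^2\<close> term and splits
  into \<open>u\<close> times a linear form in \<open>u\<close> and \<open>v\<close>, here exactly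
  the Wronskian.\<close>

lemma energy_left_node: "energy 0 = R * u (- \<alpha>) * wronskian (- \<alpha>)"
proof -
  have "energy (- \<alpha>) = R * u (- \<alpha>) * wronskian (- \<alpha>)"
    unfolding energy_def wronskian_def by (simp add: c_eq field_simps power2_eq_square)
  then show ?thesis using energy_constant[of 0 "- \<alpha>"] by simp
qed

lemma wronskian_right_node: "wronskian \<alpha> = u \<alpha> / 2"
  by (simp add: wronskian_def)

lemma wronskian_nonincreasing:
  assumes "- \<alpha> \<le> s" "s \<le> t" "t \<le> \<alpha>"
  shows "wronskian t \<le> wronskian s"
proof (rule DERIV_nonpos_imp_nonincreasing[OF assms(2)])
  fix x assume x: "s \<le> x" "x \<le> t"
  have "sin ((\<alpha> - x) / 2) * (c - R * cos x) / (2 * u x ^ 5) \<le> 0"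
    using x assms \<alpha> u_pos[of x] coefficient_nonpos[of x]
    by (intro divide_nonpos_nonneg mult_nonneg_nonpos sin_ge_zero) auto
  then show "\<exists>y. (wronskian has_real_derivative y) (at x) \<and> y \<le> 0"
    using wronskian_deriv by blast
qed

lemma node_product_le_energy: "R * u (- \<alpha>) * u \<alpha> \<le> 2 * energy 0"
proof -
  have "R * u (- \<alpha>) * (u \<alpha> / 2) \<le> R * u (- \<alpha>) * wronskian (- \<alpha>)"
    using wronskian_nonincreasing[of "- \<alpha>" \<alpha>] wronskian_right_node \<alpha> R_pos u_pos[of "- \<alpha>"]
    by (intro mult_left_mono) auto
  then show ?thesis using energy_left_node by simp
qed

lemma energy_pos: "0 < energy 0"
proof -
  have "0 < R * u (- \<alpha>) * u \<alpha>" using R_pos u_pos by simp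
  with node_product_le_energy show ?thesis by linarith
qed

text \<open>A lower bound for the drop of \<open>wronskian\<close> over \<open>[0, \<alpha>/2]\<close> when \<open>u \<le> 1\<close>.\<close>
definition gap :: real where
  "gap = \<alpha> / 2 * (sin (\<alpha> / 4) * (R * (cos (\<alpha> / 2) - cos \<alpha>)) / 2)"

lemma gap_pos: "0 < gap"
proof -
  have "cos \<alpha> < cos (\<alpha> / 2)" using \<alpha> by (intro cos_monotone_0_pi) auto
  moreover have "0 < sin (\<alpha> / 4)" using \<alpha> by (intro sin_gt_zero) auto
  ultimately show ?thesis using \<alpha> R_pos by (simp add: gap_def)
qed

text \<open>Both the sine and the coefficient vanish at \<alpha>, but on
  \<open>[0, \<alpha>/2]\<close> they stay away from zero, so the mean value theorem gives a
  definite drop there. Elsewhere monotonicity suffices.\<close>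

lemma wronskian_drop:
  assumes M: "\<And>t. \<bar>t\<bar> \<le> \<alpha> \<Longrightarrow> u t \<le> M"
  shows "u \<alpha> / 2 + gap / M ^ 5 \<le> wronskian (- \<alpha>)"
proof -
  obtain \<xi> where \<xi>: "0 < \<xi>" "\<xi> < \<alpha> / 2"
    and mvt: "wronskian (\<alpha> / 2) - wronskian 0 =
      \<alpha> / 2 * (sin ((\<alpha> - \<xi>) / 2) * (c - R * cos \<xi>) / (2 * u \<xi> ^ 5))"
  proof -
    have "\<exists>\<xi>>0. \<xi> < \<alpha> / 2 \<and> wronskian (\<alpha> / 2) - wronskian 0 =
        (\<alpha> / 2 - 0) * (sin ((\<alpha> - \<xi>) / 2) * (c - R * cos \<xi>) / (2 * u \<xi> ^ 5))"
      by (rule MVT2) (use \<alpha> in simp, rule wronskian_deriv)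
    then show thesis using that unfolding diff_0_right by blast
  qed
  have "gap / M ^ 5 \<le> \<alpha> / 2 * (sin ((\<alpha> - \<xi>) / 2) * (R * cos \<xi> - c) / (2 * u \<xi> ^ 5))"
  proof -
    have "cos (\<alpha> / 2) \<le> cos \<xi>" using \<xi> \<alpha> by (intro cos_monotone_0_pi_le) auto
    then have f: "R * (cos (\<alpha> / 2) - cos \<alpha>) \<le> R * cos \<xi> - c"
      using R_pos by (simp add: c_eq algebra_simps)
    have s: "sin (\<alpha> / 4) \<le> sin ((\<alpha> - \<xi>) / 2)" "0 < sin (\<alpha> / 4)"
      using \<xi> \<alpha> by (intro sin_monotone_2pi_le sin_gt_zero; simp)+
    have m: "2 * u \<xi> ^ 5 \<le> 2 * M ^ 5"
      using M[of \<xi>] \<xi> \<alpha> u_pos[of \<xi>] by (intro mult_left_mono power_mono) auto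
    have c: "cos \<alpha> \<le> cos (\<alpha> / 2)"
      using \<alpha> by (intro cos_monotone_0_pi_le) auto
    have "sin (\<alpha> / 4) * (R * (cos (\<alpha> / 2) - cos \<alpha>)) / (2 * M ^ 5) \<le>
        sin ((\<alpha> - \<xi>) / 2) * (R * cos \<xi> - c) / (2 * u \<xi> ^ 5)"
      using f s m c R_pos u_pos[of \<xi>] coefficient_nonpos[of \<xi>] \<xi> \<alpha> by (intro frac_le mult_mono mult_nonneg_nonneg) auto
    then have "\<alpha> / 2 * (sin (\<alpha> / 4) * (R * (cos (\<alpha> / 2) - cos \<alpha>)) / (2 * M ^ 5)) \<le>
        \<alpha> / 2 * (sin ((\<alpha> - \<xi>) / 2) * (R * cos \<xi> - c) / (2 * u \<xi> ^ 5))"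
      using \<alpha> by (intro mult_left_mono) auto
    then show ?thesis by (simp add: gap_def)
  qed
  also have "\<dots> = wronskian 0 - wronskian (\<alpha> / 2)"
  proof -
    have "sin ((\<alpha> - \<xi>) / 2) * (R * cos \<xi> - c) = - (sin ((\<alpha> - \<xi>) / 2) * (c - R * cos \<xi>))"
      by (simp add: algebra_simps)
    then show ?thesis using mvt by (metis minus_diff_eq minus_divide_left mult_minus_right)
  qed
  finally show ?thesis
    using wronskian_nonincreasing[of "- \<alpha>" 0] wronskian_nonincreasing[of "\<alpha> / 2" \<alpha>] \<alpha> wronskian_right_node by simp
qed

section \<open>The arc from \<alpha> to 2 pi - \<alpha>, where the coefficient is
  nonnegative\<close>

definition tilt :: real where
  "tilt = energy 0 / (R * sin \<alpha>)"

lemma tilt: "energy 0 = tilt * (R * sin \<alpha>)"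
  using R_pos sin_\<alpha>_pos by (simp add: tilt_def)

text \<open>
  With \<open>\<psi> = (t + \<alpha>)/2\<close> this is \<open>sin \<psi> (U' - cot \<psi> U + 2 tilt)\<close>.  The shift by \<open>tilt\<close> makes it vanish at
  \<open>\<alpha>\<close>, and \<open>sq_equation\<close> makes its quotient by \<open>sin ((t - \<alpha>)/2)\<close> nondecreasing up to \<open>2\<pi> - \<alpha>\<close>.
\<close>
definition comparison :: "real \<Rightarrow> real" where
  "comparison t = sin ((t + \<alpha>) / 2) * (2 * u t * v t) - cos ((t + \<alpha>) / 2) * (u t)\<^sup>2
     + 2 * tilt * sin ((t + \<alpha>) / 2)"

definition comparison_deriv :: "real \<Rightarrow> real" where
  "comparison_deriv t = sin ((t + \<alpha>) / 2) * sq_deriv2 t - cos ((t + \<alpha>) / 2) * (u t * v t)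
     + sin ((t + \<alpha>) / 2) * (u t)\<^sup>2 / 2 + tilt * cos ((t + \<alpha>) / 2)"

lemma comparison_deriv: "(comparison has_real_derivative comparison_deriv t) (at t)"
  unfolding comparison_def comparison_deriv_def
  by (rule uv_deriv sq_deriv derivative_eq_intros refl | (simp add: field_simps; fail))+

text \<open>Since \<open>f = 2 R sin ((t + \<alpha>)/2) sin ((t - \<alpha>)/2)\<close>, multiplying
  by \<open>2 R\<close> yields the left side of \<open>sq_equation\<close> minus twice the energy;
  only the source term survives.\<close>

lemma comparison_wronskian:
  "comparison_deriv t * sin ((t - \<alpha>) / 2) - comparison t * (cos ((t - \<alpha>) / 2) / 2)
     = (c - R * cos t)\<^sup>2 / (4 * R * u t ^ 4)"
proof -
  define s k S C where "s = sin ((t + \<alpha>) / 2)" "k = cos ((t + \<alpha>) / 2)"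
    and "S = sin ((t - \<alpha>) / 2)" "C = cos ((t - \<alpha>) / 2)"
  note d = this
  have half: "(t + \<alpha>) / 2 + (t - \<alpha>) / 2 = t" "(t + \<alpha>) / 2 - (t - \<alpha>) / 2 = \<alpha>"
    by (simp_all add: field_simps)
  have ids: "sin t = s * C + k * S" "cos t = k * C - s * S"
      "sin \<alpha> = s * C - k * S" "cos \<alpha> = k * C + s * S"
    unfolding d using sin_add[of "(t + \<alpha>) / 2" "(t - \<alpha>) / 2"] cos_add[of "(t + \<alpha>) / 2" "(t - \<alpha>) / 2"]
      sin_diff[of "(t + \<alpha>) / 2" "(t - \<alpha>) / 2"] cos_diff[of "(t + \<alpha>) / 2" "(t - \<alpha>) / 2"]
    unfolding half by auto
  have f: "c - R * cos t = 2 * R * (s * S)"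
    unfolding c_eq ids(2,4) by (simp add: algebra_simps)
  have "2 * R * (comparison_deriv t * S - comparison t * (C / 2)) =
      (c - R * cos t) * sq_deriv2 t - R * sin t * (2 * u t * v t) + R * cos \<alpha> * (u t)\<^sup>2
        - 2 * (tilt * (R * sin \<alpha>))"
    unfolding comparison_deriv_def comparison_def f
    unfolding ids(1,3,4) d[symmetric]
    by (simp add: algebra_simps)
  also have "\<dots> = (c - R * cos t)\<^sup>2 / (2 * u t ^ 4)"
    using sq_equation[of t] energy_constant[of 0 t] by (simp add: tilt[symmetric] c_eq[symmetric])
  finally show ?thesis
    unfolding d using R_pos u_pos[of t] by (simp add: field_simps)
qed

lemma energy_right_node: "energy 0 = R * u \<alpha> * (cos \<alpha> * u \<alpha> / 2 - sin \<alpha> * v \<alpha>)"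
proof -
  have "energy \<alpha> = R * u \<alpha> * (cos \<alpha> * u \<alpha> / 2 - sin \<alpha> * v \<alpha>)"
    unfolding energy_def by (simp add: c_eq field_simps power2_eq_square)
  then show ?thesis using energy_constant[of 0 \<alpha>] by simp
qed

text \<open>The monotone quotient of \<open>comparison\<close> by
  \<open>sin ((t - \<alpha>)/2)\<close> tends to \<open>4 w^2 / sin \<alpha>\<close> at \<alpha> and
  equals \<open>u^2 / sin \<alpha>\<close> at \<open>2 pi - \<alpha>\<close>. As the energy is
  \<open>R * u \<alpha> * w\<close>, comparing the ends gives the bound.\<close>

lemma energy_le_node_product: "2 * \<bar>energy 0\<bar> \<le> R * u \<alpha> * u (2 * pi - \<alpha>)"
proof -
  let ?S = "\<lambda>t. sin ((t - \<alpha>) / 2)" and ?\<beta> = "2 * pi - \<alpha>"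
  define w where "w = cos \<alpha> * u \<alpha> / 2 - sin \<alpha> * v \<alpha>"
  have node: "energy 0 = R * u \<alpha> * w"
    using energy_right_node by (simp add: w_def)
  have S: "(?S has_real_derivative cos ((t - \<alpha>) / 2) / 2) (at t)" for t
    by (rule derivative_eq_intros refl | simp)+
  have E: "tilt * sin \<alpha> = u \<alpha> * w"
    using node R_pos by (simp add: tilt)
  have zero: "comparison \<alpha> = 0"
    using E by (simp add: w_def comparison_def algebra_simps power2_eq_square)
  have "comparison_deriv \<alpha> * sin \<alpha> = 2 * w\<^sup>2"
  proof -
    have "comparison_deriv \<alpha> * sin \<alpha> =
      sin \<alpha> * sin \<alpha> * sq_deriv2 \<alpha> - cos \<alpha> * sin \<alpha> * (u \<alpha> * v \<alpha>)
       + sin \<alpha> * sin \<alpha> * (u \<alpha>)\<^sup>2 / 2 + tilt * sin \<alpha> * cos \<alpha>"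
      by (simp add: comparison_deriv_def algebra_simps)
    also have "\<dots> = 2 * w\<^sup>2"
    proof -
      have "sq_deriv2 \<alpha> = 2 * (v \<alpha>)\<^sup>2 - (u \<alpha>)\<^sup>2 / 2"
        unfolding sq_deriv2_def by (simp add: c_eq)
      then show ?thesis unfolding E by (simp only:) (simp add: w_def field_simps power2_eq_square)
    qed
    finally show ?thesis .
  qed
  then have d: "comparison_deriv \<alpha> = 2 * w\<^sup>2 / sin \<alpha>"
    using sin_\<alpha>_pos by (simp add: field_simps)
  have b: "comparison ?\<beta> / ?S ?\<beta> = (u ?\<beta>)\<^sup>2 / sin \<alpha>"
  proof -
    have "(?\<beta> - \<alpha>) / 2 = pi - \<alpha>" by (simp add: field_simps)
    then show ?thesis unfolding comparison_def by (simp only:) simp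
  qed
  have "((\<lambda>t. comparison t / ?S t) \<longlongrightarrow> comparison_deriv \<alpha> / (cos ((\<alpha> - \<alpha>) / 2) / 2)) (at \<alpha>)"
    by (rule tendsto_quotient_at_common_zero[OF comparison_deriv zero S]) auto
  then have lim: "((\<lambda>t. comparison t / ?S t) \<longlongrightarrow> 2 * comparison_deriv \<alpha>) (at_right \<alpha>)"
    by (auto intro: filterlim_at_split[THEN iffD1, THEN conjunct2] simp: mult.commute)
  have ev: "\<forall>\<^sub>F t in at_right \<alpha>. comparison t / ?S t \<le> comparison ?\<beta> / ?S ?\<beta>"
    unfolding eventually_at_right_field
  proof (intro exI[of _ ?\<beta>] conjI allI impI)
    show "\<alpha> < ?\<beta>" using \<alpha> by simp
    fix t assume t: "\<alpha> < t" "t < ?\<beta>"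
    show "comparison t / ?S t \<le> comparison ?\<beta> / ?S ?\<beta>"
    proof (rule quotient_nondecreasing[OF _ comparison_deriv S])
      fix x assume x: "t \<le> x" "x \<le> ?\<beta>"
      have "0 < ?S x" using x t \<alpha> by (intro sin_gt_zero) auto
      then show "?S x \<noteq> 0" by simp
      show "0 \<le> comparison_deriv x * ?S x - comparison x * (cos ((x - \<alpha>) / 2) / 2)"
        unfolding comparison_wronskian using R_pos u_pos[of x] by simp
    qed (use t in simp)
  qed
  have "2 * (2 * w\<^sup>2 / sin \<alpha>) \<le> (u ?\<beta>)\<^sup>2 / sin \<alpha>"
    using tendsto_upperbound[OF lim ev] unfolding d b by simp
  then have "4 * w\<^sup>2 \<le> (u ?\<beta>)\<^sup>2"
    using sin_\<alpha>_pos by (simp add: divide_le_cancel)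
  then have "(2 * w)\<^sup>2 \<le> (u ?\<beta>)\<^sup>2"
    by (simp only: power_mult_distrib) simp
  then have "2 * \<bar>w\<bar> \<le> u ?\<beta>"
    using abs_le_square_iff[of "2 * w" "u ?\<beta>"] u_pos[of ?\<beta>] by (simp add: abs_mult)
  then have "R * u \<alpha> * (2 * \<bar>w\<bar>) \<le> R * u \<alpha> * u ?\<beta>"
    using R_pos u_pos[of \<alpha>] by (intro mult_left_mono) auto
  then show ?thesis
    using R_pos u_pos[of \<alpha>] by (simp add: node abs_mult)
qed

section \<open>Growth of the node values and its consequences\<close>

lemma node_growth:
  assumes M: "\<And>t. \<bar>t\<bar> \<le> \<alpha> \<Longrightarrow> u t \<le> M"
  shows "u (- \<alpha>) * (1 + 2 * gap / M ^ 6) \<le> u (- \<alpha> + 2 * pi)"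
proof -
  let ?a = "u (- \<alpha>)" and ?b = "u \<alpha>" and ?a' = "u (2 * pi - \<alpha>)"
  have M0: "0 < M" using M[of 0] \<alpha> u_pos[of 0] by simp
  have b: "0 < ?b" "?b \<le> M" using u_pos M[of \<alpha>] \<alpha> by auto
  have "R * ?a * (?b / 2 + gap / M ^ 5) \<le> R * ?a * wronskian (- \<alpha>)"
    using wronskian_drop[OF M] R_pos u_pos[of "- \<alpha>"] by (intro mult_left_mono) auto
  also have "\<dots> \<le> R * ?b * ?a' / 2"
    using energy_le_node_product energy_left_node by linarith
  finally have "R * (?a * (?b + 2 * gap / M ^ 5)) \<le> R * (?b * ?a')"
    by (simp add: algebra_simps)
  then have 1: "?a * (?b + 2 * gap / M ^ 5) \<le> ?b * ?a'"
    using R_pos by simp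
  \<comment> \<open>Trading one power of \<open>M\<close> for \<open>b\<close> lets \<open>b\<close>
    cancel, leaving a growth factor independent of \<open>b\<close>.\<close>
  have "?b * (2 * gap / M ^ 6) \<le> M * (2 * gap / M ^ 6)"
    using b gap_pos by (intro mult_right_mono) auto
  also have "\<dots> = 2 * gap / M ^ 5"
    using M0 power_Suc[of M 5] by simp
  finally have "?a * (?b + ?b * (2 * gap / M ^ 6)) \<le> ?a * (?b + 2 * gap / M ^ 5)"
    using u_pos[of "- \<alpha>"] by (intro mult_left_mono) auto
  with 1 have "?b * (?a * (1 + 2 * gap / M ^ 6)) \<le> ?b * ?a'"
    by (simp add: algebra_simps)
  then have "?a * (1 + 2 * gap / M ^ 6) \<le> ?a'" using b by simp
  then show ?thesis by (simp only: uminus_add_conv_diff)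
qed

lemma unbounded_on_negative_arcs:
  "\<exists>k t. \<bar>t\<bar> \<le> \<alpha> \<and> M < u (t + real k * (2 * pi))"
proof (rule ccontr)
  assume "\<not> ?thesis"
  then have M: "u (t + real k * (2 * pi)) \<le> M" if "\<bar>t\<bar> \<le> \<alpha>" for k t
    using that by (meson not_le)
  have M0: "0 < M" using M[of 0 0] \<alpha> u_pos[of 0] by simp
  define q where "q = 1 + 2 * gap / M ^ 6"
  have q: "1 < q" using gap_pos M0 by (simp add: q_def)
  have growth: "u (- \<alpha>) * q ^ k \<le> u (- \<alpha> + real k * (2 * pi))" for k
  proof (induction k)
    case (Suc k)
    interpret shifted: oscillating_solution c R "\<lambda>t. u (t + real k * (2 * pi))"
        "\<lambda>t. v (t + real k * (2 * pi))" \<alpha>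
      by (rule oscillating_shift_periods)
    have "u (- \<alpha>) * q ^ Suc k \<le> u (- \<alpha> + real k * (2 * pi)) * q"
      using Suc.IH q by (simp add: mult.assoc mult.left_commute)
    \<comment> \<open>\<open>gap\<close> depends only on \<alpha> and \<open>R\<close>, so the same
      factor serves every period.\<close>
    also have "\<dots> \<le> u (- \<alpha> + 2 * pi + real k * (2 * pi))"
      unfolding q_def using shifted.node_growth[of M] M by (simp add: gap_def)
    finally show ?case by (simp add: algebra_simps)
  qed simp
  obtain k where "M / u (- \<alpha>) < q ^ k"
    using real_arch_pow[OF q] by blast
  then have "M < u (- \<alpha>) * q ^ k"
    using u_pos[of "- \<alpha>"] by (simp add: field_simps)
  with growth[of k] M[of "- \<alpha>" k] \<alpha> show False by simp
qed

text \<open>As \<open>u\<close> is at least \<open>m\<close> at both nodes,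
  \<open>node_product_le_energy\<close> bounds \<open>u (- \<alpha>)\<close> and
  \<open>energy_left_node\<close> bounds the Wronskian, hence the slope at -\<alpha>. On the arc
  \<open>u\<close> is concave and stays below that tangent.\<close>

lemma bounded_on_negative_arc:
  assumes m: "0 < m" "\<And>t. m \<le> u t" and t: "\<bar>t\<bar> \<le> \<alpha>"
  shows "u t \<le> 2 * energy 0 / (R * m) + 2 * energy 0 / (R * m) / sin \<alpha> * (2 * pi)"
proof -
  let ?a = "u (- \<alpha>)"
  define K where "K = 2 * energy 0 / (R * m)"
  have K: "0 < K" "R * m * K = 2 * energy 0"
    using energy_pos R_pos m(1) by (simp_all add: K_def)
  have "R * ?a * m \<le> R * ?a * u \<alpha>"
    using m(2)[of \<alpha>] R_pos u_pos[of "- \<alpha>"] by (intro mult_left_mono) auto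
  with node_product_le_energy have "R * ?a * m \<le> R * m * K" using K(2) by linarith
  then have "(R * m) * ?a \<le> (R * m) * K" by (simp only: mult_ac)
  then have a: "?a \<le> K"
    using R_pos m(1) by simp
  have "R * wronskian (- \<alpha>) * m \<le> energy 0"
  proof -
    have "0 < wronskian (- \<alpha>)"
      using zero_less_mult_pos[of "R * u (- \<alpha>)" "wronskian (- \<alpha>)"]
        energy_left_node energy_pos R_pos u_pos[of "- \<alpha>"] by simp
    then have "R * wronskian (- \<alpha>) * m \<le> R * wronskian (- \<alpha>) * ?a"
      using m(2)[of "- \<alpha>"] R_pos by (intro mult_left_mono) auto
    also have "\<dots> = R * ?a * wronskian (- \<alpha>)" by (simp only: mult_ac)
    finally show ?thesis using energy_left_node by linarith
  qed
  then have "(R * m) * (2 * wronskian (- \<alpha>)) \<le> (R * m) * K"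
    using K(2) by (simp add: mult_ac)
  then have w: "wronskian (- \<alpha>) \<le> K / 2"
    using R_pos m(1) by simp
  have "- 1 * (?a / 2) \<le> cos \<alpha> * (?a / 2)"
    using u_pos[of "- \<alpha>"] by (intro mult_right_mono) auto
  then have "sin \<alpha> * v (- \<alpha>) \<le> K"
    using w a unfolding wronskian_def by simp
  then have v: "v (- \<alpha>) \<le> K / sin \<alpha>"
    using sin_\<alpha>_pos by (simp add: pos_le_divide_eq mult.commute)
  obtain \<xi> where \<xi>: "- \<alpha> \<le> \<xi>" "\<xi> \<le> t" and taylor: "u t = ?a + v (- \<alpha>) * (t - - \<alpha>)
      + ((c - R * cos \<xi>) / (2 * u \<xi> ^ 5) - u \<xi> / 4) / 2 * (t - - \<alpha>)\<^sup>2"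
  proof -
    have "min (- \<alpha>) t = - \<alpha>" "max (- \<alpha>) t = t" using t by auto
    then show thesis using that second_order_expansion[of "- \<alpha>" t] by metis
  qed
  have "(c - R * cos \<xi>) / (2 * u \<xi> ^ 5) \<le> 0"
    using coefficient_nonpos[of \<xi>] \<xi> t u_pos[of \<xi>] by (intro divide_nonpos_pos) auto
  then have "(c - R * cos \<xi>) / (2 * u \<xi> ^ 5) - u \<xi> / 4 \<le> 0"
    using u_pos[of \<xi>] by linarith
  then have "((c - R * cos \<xi>) / (2 * u \<xi> ^ 5) - u \<xi> / 4) / 2 \<le> 0"
    by (rule divide_nonpos_pos) simp
  then have "((c - R * cos \<xi>) / (2 * u \<xi> ^ 5) - u \<xi> / 4) / 2 * (t - - \<alpha>)\<^sup>2 \<le> 0"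
    by (rule mult_nonpos_nonneg) simp
  moreover have "v (- \<alpha>) * (t - - \<alpha>) \<le> K / sin \<alpha> * (t - - \<alpha>)"
    using v t by (intro mult_right_mono) auto
  moreover have "K / sin \<alpha> * (t - - \<alpha>) \<le> K / sin \<alpha> * (2 * pi)"
    using K sin_\<alpha>_pos t \<alpha> by (intro mult_left_mono divide_nonneg_pos) auto
  ultimately show ?thesis unfolding K_def[symmetric] using taylor a by linarith
qed

text \<open>Makes the bound of \<open>bounded_on_negative_arc\<close> the same in every
  period.\<close>

lemma shifted_energy:
  "rotated_solution.energy c R (\<lambda>t. u (t + real k * (2 * pi))) (\<lambda>t. v (t + real k * (2 * pi))) t
     = energy (t + real k * (2 * pi))"
proof -
  interpret shifted: rotated_solution c R "\<lambda>t. u (t + real k * (2 * pi))" "\<lambda>t. v (t + real k * (2 * pi))"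
    by (rule shift_periods)
  show ?thesis
    using cos.plus_of_nat[of t k] sin.plus_of_nat[of t k]
    by (simp add: shifted.energy_def energy_def)
qed

lemma no_positive_lower_bound: "\<exists>t. u t < m" if "0 < m"
proof (rule ccontr)
  assume "\<not> ?thesis"
  then have m: "m \<le> u t" for t by (meson not_le)
  define M where "M = 2 * energy 0 / (R * m) + 2 * energy 0 / (R * m) / sin \<alpha> * (2 * pi)"
  obtain k t where t: "\<bar>t\<bar> \<le> \<alpha>" "M < u (t + real k * (2 * pi))"
    using unbounded_on_negative_arcs by blast
  interpret shifted: oscillating_solution c R "\<lambda>t. u (t + real k * (2 * pi))"
      "\<lambda>t. v (t + real k * (2 * pi))" \<alpha>
    by (rule oscillating_shift_periods)
  have "shifted.energy 0 = energy 0"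
    using shifted_energy[of k 0] energy_constant[of "0 + real k * (2 * pi)" 0] by simp
  then have "u (t + real k * (2 * pi)) \<le> M"
    using shifted.bounded_on_negative_arc[OF \<open>0 < m\<close> m t(1)] by (simp add: M_def)
  with t(2) show False by simp
qed

end

subsection \<open>Double zeros of the coefficient\<close>

text \<open>Of the two cases \<open>c = R\<close> and \<open>c = - R\<close> the second is excluded
  by \<open>coefficient_not_nonpositive\<close>.\<close>

locale degenerate_solution = rotated_solution R R u v for R :: real and u v :: "real \<Rightarrow> real"
begin

lemma R_pos: "0 < R"
  using coefficient_not_nonpositive by simp

lemma degenerate_shift_periods:
  "degenerate_solution R (\<lambda>t. u (t + real k * (2 * pi))) (\<lambda>t. v (t + real k * (2 * pi)))"
  using shift_periods[of k] by (simp add: degenerate_solution_def)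

lemma energy_zero: "energy 0 = R / 2 * (u 0)\<^sup>2"
  by (simp add: energy_def)

text \<open>At multiples of \<open>2 pi\<close> both \<open>f\<close> and \<open>f'\<close> vanish,
  so the energy reduces to \<open>R/2 * u^2\<close> and conservation fixes \<open>u\<close>. This is
  the source of claim (iii).\<close>

lemma node_value: "u (real k * (2 * pi)) = u 0"
proof -
  have "cos (real k * (2 * pi)) = 1" "sin (real k * (2 * pi)) = 0"
    using cos.plus_of_nat[of "0::real" k] sin.plus_of_nat[of "0::real" k] by simp_all
  then have "energy (real k * (2 * pi)) = R / 2 * (u (real k * (2 * pi)))\<^sup>2"
    by (simp add: energy_def)
  then have "(u (real k * (2 * pi)))\<^sup>2 = (u 0)\<^sup>2"
    using energy_constant[of "real k * (2 * pi)" 0] energy_zero R_pos by simp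
  then show ?thesis using u_pos by (simp add: less_imp_le)
qed

text \<open>\<open>sin (t/2) (Z' - cot (t/2) Z)\<close> for \<open>Z = u\<^sup>2 - (u 0)\<^sup>2\<close>, written without poles.\<close>
definition comparison :: "real \<Rightarrow> real" where
  "comparison t = sin (t / 2) * (2 * u t * v t) - cos (t / 2) * ((u t)\<^sup>2 - (u 0)\<^sup>2)"

definition comparison_deriv :: "real \<Rightarrow> real" where
  "comparison_deriv t = sin (t / 2) * sq_deriv2 t - cos (t / 2) * (u t * v t)
     + sin (t / 2) * ((u t)\<^sup>2 - (u 0)\<^sup>2) / 2"

lemma comparison_deriv: "(comparison has_real_derivative comparison_deriv t) (at t)"
  unfolding comparison_def comparison_deriv_def
  by (rule uv_deriv sq_deriv derivative_eq_intros refl | (simp add: field_simps; fail))+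

lemma sin_half_deriv: "((\<lambda>t. sin (t / 2)) has_real_derivative cos (t / 2) / 2) (at t)"
  by (rule derivative_eq_intros refl | simp)+

lemma coefficient_half_angle: "R - R * cos t = 2 * R * (sin (t / 2))\<^sup>2"
proof -
  have "cos t = 1 - 2 * (sin (t / 2))\<^sup>2" using cos_double_sin[of "t / 2"] by simp
  then show ?thesis by (simp only:) (simp add: algebra_simps)
qed

text \<open>By \<open>energy_zero\<close> the constant \<open>(u 0)^2\<close> absorbs the energy
  term of \<open>sq_equation\<close>, leaving only the source.\<close>

lemma comparison_wronskian:
  "comparison_deriv t * sin (t / 2) - comparison t * (cos (t / 2) / 2)
     = (R - R * cos t)\<^sup>2 / (4 * R * u t ^ 4)"
proof -
  have s: "sin t = 2 * sin (t / 2) * cos (t / 2)"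
    using sin_double[of "t / 2"] by simp
  have poly: "2 * R * ((S * q - C * p + S * z / 2) * S - (S * (2 * p) - C * z) * (C / 2)) =
      2 * R * S\<^sup>2 * q - R * (2 * S * C) * (2 * p) + R * z + R * z * (S\<^sup>2 + C\<^sup>2 - 1)"
    for S q C p z :: real
    by (simp add: field_simps power2_eq_square)
  have "2 * R * (comparison_deriv t * sin (t / 2) - comparison t * (cos (t / 2) / 2)) =
     (R - R * cos t) * sq_deriv2 t - R * sin t * (2 * u t * v t)
       + R * ((u t)\<^sup>2 - (u 0)\<^sup>2)"
    using poly[of "sin (t / 2)" "sq_deriv2 t" "cos (t / 2)" "u t * v t" "(u t)\<^sup>2 - (u 0)\<^sup>2"]
    unfolding coefficient_half_angle s comparison_deriv_def comparison_def by (simp add: mult.assoc)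
  also have "\<dots> = (R - R * cos t)\<^sup>2 / (2 * u t ^ 4)"
    using sq_equation[of t] energy_constant[of t 0] energy_zero by (simp add: algebra_simps)
  finally show ?thesis
    using R_pos u_pos[of t] by (simp add: field_simps)
qed

text \<open>The squared sine in the denominator is \<open>f/(2 R)\<close> and cancels one of the two
  factors \<open>f\<close>.\<close>

lemma quotient_deriv:
  assumes "0 < t" "t < 2 * pi"
  shows "((\<lambda>t. comparison t / sin (t / 2)) has_real_derivative (R - R * cos t) / (2 * u t ^ 4)) (at t)"
proof -
  have s: "0 < sin (t / 2)" using assms by (intro sin_gt_zero) auto
  have "(comparison_deriv t * sin (t / 2) - comparison t * (cos (t / 2) / 2)) / (sin (t / 2) * sin (t / 2))
      = (R - R * cos t) / (2 * u t ^ 4)"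
    unfolding comparison_wronskian coefficient_half_angle
    using s R_pos u_pos[of t] by (simp add: field_simps power2_eq_square)
  then show ?thesis
    using DERIV_divide[OF comparison_deriv sin_half_deriv, of t] s by simp
qed

lemma quotient_mono:
  assumes "0 < s" "s \<le> t" "t < 2 * pi"
  shows "comparison s / sin (s / 2) \<le> comparison t / sin (t / 2)"
proof (rule quotient_nondecreasing[OF assms(2) comparison_deriv sin_half_deriv])
  fix x assume x: "s \<le> x" "x \<le> t"
  have "0 < sin (x / 2)" using x assms by (intro sin_gt_zero) auto
  then show "sin (x / 2) \<noteq> 0" by simp
  show "0 \<le> comparison_deriv x * sin (x / 2) - comparison x * (cos (x / 2) / 2)"
    unfolding comparison_wronskian using R_pos u_pos[of x] by simp
qed

text \<open>The nondecreasing quotient has limits \<open>- 2 * u 0 * v 0\<close> at 0 and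
  \<open>- 2 * u 0 * v (2 * pi)\<close> at \<open>2 pi\<close>, so any increase in between forces a
  drop of the slope.\<close>

lemma slope_drop_by_quotient:
  assumes "0 < s" "s \<le> t" "t < 2 * pi"
  shows "2 * u 0 * v (2 * pi) \<le> 2 * u 0 * v 0
    - (comparison t / sin (t / 2) - comparison s / sin (s / 2))"
proof -
  let ?Q = "\<lambda>t. comparison t / sin (t / 2)"
  have node: "u (2 * pi) = u 0" using node_value[of 1] by simp
  have "(?Q \<longlongrightarrow> comparison_deriv 0 / (cos (0 / 2) / 2)) (at 0)"
    by (rule tendsto_quotient_at_common_zero[OF comparison_deriv _ sin_half_deriv])
      (auto simp: comparison_def)
  then have l0: "(?Q \<longlongrightarrow> - (2 * u 0 * v 0)) (at_right 0)"
    by (simp add: comparison_deriv_def filterlim_at_split mult_ac)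
  have "comparison_deriv (2 * pi) / (cos (2 * pi / 2) / 2) = - (2 * u 0 * v (2 * pi))"
    by (simp add: comparison_deriv_def node)
  moreover have "(?Q \<longlongrightarrow> comparison_deriv (2 * pi) / (cos (2 * pi / 2) / 2)) (at (2 * pi))"
    by (rule tendsto_quotient_at_common_zero[OF comparison_deriv _ sin_half_deriv])
      (auto simp: comparison_def node)
  ultimately have l1: "(?Q \<longlongrightarrow> - (2 * u 0 * v (2 * pi))) (at_left (2 * pi))"
    by (simp only: filterlim_at_split)
  have "\<forall>\<^sub>F x in at_right 0. ?Q x \<le> ?Q s"
    unfolding eventually_at_right_field
    using assms quotient_mono by (intro exI[of _ s]) auto
  from tendsto_upperbound[OF l0 this] have "- (2 * u 0 * v 0) \<le> ?Q s" by simp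
  moreover have "\<forall>\<^sub>F x in at_left (2 * pi). ?Q t \<le> ?Q x"
    unfolding eventually_at_left_field
    using assms quotient_mono by (intro exI[of _ t]) auto
  from tendsto_lowerbound[OF l1 this] have "?Q t \<le> - (2 * u 0 * v (2 * pi))" by simp
  ultimately show ?thesis by linarith
qed

lemma slope_nonincreasing: "v (2 * pi) \<le> v 0"
  using slope_drop_by_quotient[of pi pi] u_pos[of 0] by simp

text \<open>On the middle half of the period \<open>cos\<close> is nonpositive, so the coefficient
  is at least \<open>R\<close> there.\<close>

lemma slope_drop:
  assumes M: "\<And>t. 0 \<le> t \<Longrightarrow> t \<le> 2 * pi \<Longrightarrow> u t \<le> M"
  shows "v (2 * pi) \<le> v 0 - pi * R / (4 * u 0 * M ^ 4)"
proof -
  let ?Q = "\<lambda>t. comparison t / sin (t / 2)"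
  obtain \<xi> where \<xi>: "pi / 2 < \<xi>" "\<xi> < 3 * pi / 2"
    and mvt: "?Q (3 * pi / 2) - ?Q (pi / 2) =
      (3 * pi / 2 - pi / 2) * ((R - R * cos \<xi>) / (2 * u \<xi> ^ 4))"
  proof -
    have "\<exists>\<xi>>pi / 2. \<xi> < 3 * pi / 2 \<and> ?Q (3 * pi / 2) - ?Q (pi / 2) =
        (3 * pi / 2 - pi / 2) * ((R - R * cos \<xi>) / (2 * u \<xi> ^ 4))"
    proof (rule MVT2)
      fix x assume "pi / 2 \<le> x" "x \<le> 3 * pi / 2"
      then show "(?Q has_real_derivative (R - R * cos x) / (2 * u x ^ 4)) (at x)"
        using pi_gt_zero by (intro quotient_deriv) linarith+
    qed simp
    then show thesis using that by blast
  qed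
  have "cos \<xi> \<le> 0"
  proof -
    have "0 \<le> cos (\<xi> - pi)" using \<xi> by (intro cos_ge_zero) auto
    then show ?thesis by simp
  qed
  then have "R \<le> R - R * cos \<xi>" using R_pos by (simp add: mult_nonneg_nonpos)
  moreover have "2 * u \<xi> ^ 4 \<le> 2 * M ^ 4"
    using M[of \<xi>] \<xi> u_pos[of \<xi>] by (intro mult_left_mono power_mono) auto
  ultimately have "R / (2 * M ^ 4) \<le> (R - R * cos \<xi>) / (2 * u \<xi> ^ 4)"
    using R_pos u_pos[of \<xi>] by (intro frac_le) auto
  then have "pi * (R / (2 * M ^ 4)) \<le> ?Q (3 * pi / 2) - ?Q (pi / 2)"
    unfolding mvt using R_pos by (intro mult_mono) auto
  then have "2 * u 0 * v (2 * pi) \<le> 2 * u 0 * v 0 - pi * (R / (2 * M ^ 4))"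
    using slope_drop_by_quotient[of "pi / 2" "3 * pi / 2"] by simp
  also have "\<dots> = 2 * u 0 * (v 0 - pi * R / (4 * u 0 * M ^ 4))"
    using u_pos[of 0] by (simp add: field_simps)
  finally show ?thesis using u_pos[of 0] by simp
qed

lemma slope_nonincreasing_periods: "v (real k * (2 * pi)) \<le> v 0"
proof (induction k)
  case (Suc k)
  interpret shifted: degenerate_solution R "\<lambda>t. u (t + real k * (2 * pi))" "\<lambda>t. v (t + real k * (2 * pi))"
    by (rule degenerate_shift_periods)
  show ?case using shifted.slope_nonincreasing Suc.IH by (simp add: algebra_simps)
qed simp

lemma slope_unbounded_below:
  assumes M: "\<And>k t. 0 \<le> t \<Longrightarrow> t \<le> 2 * pi \<Longrightarrow> u (t + real k * (2 * pi)) \<le> M"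
  shows "\<exists>k>0. v (real k * (2 * pi)) < L"
proof -
  define d where "d = pi * R / (4 * u 0 * M ^ 4)"
  have "0 < M" using M[of 0 0] u_pos[of 0] by simp
  then have d: "0 < d" using R_pos u_pos[of 0] by (simp add: d_def)
  have drop: "v (real k * (2 * pi)) \<le> v 0 - real k * d" for k
  proof (induction k)
    case (Suc k)
    interpret shifted: degenerate_solution R "\<lambda>t. u (t + real k * (2 * pi))" "\<lambda>t. v (t + real k * (2 * pi))"
      by (rule degenerate_shift_periods)
    have "v (2 * pi + real k * (2 * pi)) \<le> v (real k * (2 * pi)) - d"
      using shifted.slope_drop[of M] M by (simp add: d_def node_value)
    then show ?case using Suc.IH by (simp add: algebra_simps)
  qed simp
  obtain k where k: "v 0 - L < real k * d"
    using ex_less_of_nat_mult[OF d] by blast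
  also have "real k * d \<le> real (Suc k) * d" using d by simp
  finally have "v (real (Suc k) * (2 * pi)) < L" using drop[of "Suc k"] by linarith
  then show ?thesis by blast
qed

lemma no_upper_bound: "\<exists>t. M < u t"
proof (rule ccontr)
  assume "\<not> ?thesis"
  then have M: "u t \<le> M" for t by (meson not_le)
  obtain k where k: "v (real k * (2 * pi)) < - M"
    using slope_unbounded_below[of M "- M"] M by blast
  let ?p = "real k * (2 * pi)"
  \<comment> \<open>Two units to the left of a steep descent, the slope contributes more than
    \<open>2 M\<close> while the second-order term costs at most \<open>M/2\<close>.\<close>
  obtain \<xi> where "u (?p - 2) = u ?p + v ?p * (?p - 2 - ?p)
      + ((R - R * cos \<xi>) / (2 * u \<xi> ^ 5) - u \<xi> / 4) / 2 * (?p - 2 - ?p)\<^sup>2"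
    using second_order_expansion[of ?p "?p - 2"] by blast
  then have "u (?p - 2) = u ?p - 2 * v ?p + 2 * ((R - R * cos \<xi>) / (2 * u \<xi> ^ 5)) - u \<xi> / 2"
    by (simp add: diff_divide_distrib)
  moreover have "0 \<le> (R - R * cos \<xi>) / (2 * u \<xi> ^ 5)"
    using coefficient_bounds(1)[of \<xi>] u_pos[of \<xi>] by simp
  ultimately show False
    using k M[of "?p - 2"] M[of \<xi>] u_pos[of ?p] u_pos[of \<xi>] by linarith
qed

text \<open>A lower bound on \<open>u\<close> bounds \<open>u''\<close> above by \<open>C\<close>.
  With node slopes at most \<open>v 0\<close> this bounds \<open>u\<close> on all later periods, so
  node slopes become arbitrarily negative and drive \<open>u\<close> below zero within one
  unit.\<close>

lemma no_positive_lower_bound: "\<exists>t. u t < m" if "0 < m"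
proof (rule ccontr)
  assume "\<not> ?thesis"
  then have m: "m \<le> u t" for t by (meson not_le)
  define C where "C = R / m ^ 5"
  have C: "0 < C" using R_pos that by (simp add: C_def)
  have upper: "u (t + real k * (2 * pi)) \<le> u 0 + v (real k * (2 * pi)) * t + C / 2 * t\<^sup>2" for k t
  proof -
    let ?p = "real k * (2 * pi)"
    obtain \<xi> where \<xi>: "u (t + ?p) = u ?p + v ?p * (t + ?p - ?p)
        + ((R - R * cos \<xi>) / (2 * u \<xi> ^ 5) - u \<xi> / 4) / 2 * (t + ?p - ?p)\<^sup>2"
      using second_order_expansion[of ?p "t + ?p"] by blast
    have "(R - R * cos \<xi>) / (2 * u \<xi> ^ 5) \<le> (2 * R) / (2 * m ^ 5)"
      using coefficient_bounds[of \<xi>] m[of \<xi>] that R_pos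
      by (intro frac_le mult_left_mono power_mono) auto
    then have "((R - R * cos \<xi>) / (2 * u \<xi> ^ 5) - u \<xi> / 4) / 2 * t\<^sup>2 \<le> C / 2 * t\<^sup>2"
      using u_pos[of \<xi>] by (intro mult_right_mono) (auto simp: C_def)
    with \<xi> show ?thesis by (simp add: node_value)
  qed
  define M where "M = u 0 + \<bar>v 0\<bar> * (2 * pi) + C / 2 * (2 * pi)\<^sup>2"
  have "u (t + real k * (2 * pi)) \<le> M" if t: "0 \<le> t" "t \<le> 2 * pi" for k t
  proof -
    have "v (real k * (2 * pi)) * t \<le> \<bar>v 0\<bar> * t"
      using slope_nonincreasing_periods[of k] t by (intro mult_right_mono) auto
    also have "\<dots> \<le> \<bar>v 0\<bar> * (2 * pi)" using t by (intro mult_left_mono) auto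
    finally have "v (real k * (2 * pi)) * t \<le> \<bar>v 0\<bar> * (2 * pi)" .
    moreover have "C / 2 * t\<^sup>2 \<le> C / 2 * (2 * pi)\<^sup>2"
      using t C by (intro mult_left_mono power_mono) auto
    ultimately show ?thesis using upper[of t k] by (simp add: M_def)
  qed
  then obtain k where "v (real k * (2 * pi)) < - (u 0 + C / 2)"
    using slope_unbounded_below[of M "- (u 0 + C / 2)"] by blast
  then show False using upper[of 1 k] u_pos[of "1 + real k * (2 * pi)"] by simp
qed

end

subsection \<open>Reduction to the rotated equation\<close>

lemma INF_eq_0_if_pos:
  fixes u :: "'a \<Rightarrow> real"
  assumes "\<And>t. 0 < u t" "\<And>m. 0 < m \<Longrightarrow> \<exists>t. u t < m"
  shows "(INF t. u t) = 0"
proof (rule cInf_eq)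
  fix y assume y: "\<And>x. x \<in> range u \<Longrightarrow> y \<le> x"
  show "y \<le> 0" using assms(2)[of y] y by (meson not_le rangeI)
qed (use assms(1) less_imp_le in auto)

lemma not_bounded_range_if:
  fixes u :: "'a \<Rightarrow> real"
  assumes "\<And>M. \<exists>t. M < u t"
  shows "\<not> bounded (range u)"
proof
  assume "bounded (range u)"
  then obtain B where "\<bar>u t\<bar> \<le> B" for t by (auto simp: bounded_iff)
  with assms[of B] show False by (metis abs_le_D1 not_le)
qed

lemma rotate_positive_solution:
  assumes "positive_solution c1 c2 c3 u"
  obtains R \<tau> where "c2 = R * cos \<tau>" "c3 = R * sin \<tau>"
    "rotated_solution c1 R (\<lambda>t. u (t + \<tau>)) (\<lambda>t. deriv u (t + \<tau>))"
proof -
  have pos: "0 < u t" and du: "u differentiable (at t)" and dv: "deriv u differentiable (at t)"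
    and ode: "deriv (deriv u) t + 1 / (2 * u t ^ 5) * (- c1 + c2 * cos t + c3 * sin t) + u t / 4 = 0"
    for t using assms by (auto simp: positive_solution_def)
  obtain r a where ra: "c2 = r * cos a" "c3 = r * sin a" using polar_Ex by blast
  obtain R \<tau> where R: "0 \<le> R" and c: "c2 = R * cos \<tau>" "c3 = R * sin \<tau>"
  proof (cases "0 \<le> r")
    case False
    \<comment> \<open>A half turn makes the polar radius nonnegative.\<close>
    show ?thesis by (rule that[of "- r" "a + pi"]) (use False ra in auto)
  qed (use that ra in blast)
  have "rotated_solution c1 R (\<lambda>t. u (t + \<tau>)) (\<lambda>t. deriv u (t + \<tau>))"
  proof
    fix t
    show "((\<lambda>t. u (t + \<tau>)) has_real_derivative deriv u (t + \<tau>)) (at t)"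
      using du DERIV_shift DERIV_deriv_iff_real_differentiable by blast
    have "c2 * cos (t + \<tau>) + c3 * sin (t + \<tau>) = R * cos t"
    proof -
      have "R * cos (t + \<tau> - \<tau>) = c2 * cos (t + \<tau>) + c3 * sin (t + \<tau>)"
        unfolding cos_diff c by (simp add: algebra_simps)
      then show ?thesis by simp
    qed
    then have "deriv (deriv u) (t + \<tau>) + 1 / (2 * u (t + \<tau>) ^ 5) * (R * cos t - c1) + u (t + \<tau>) / 4 = 0"
      using ode[of "t + \<tau>"] by (simp add: algebra_simps)
    then have "deriv (deriv u) (t + \<tau>) = (c1 - R * cos t) / (2 * u (t + \<tau>) ^ 5) - u (t + \<tau>) / 4"
      by (simp add: diff_divide_distrib right_diff_distrib)
    then show "((\<lambda>t. deriv u (t + \<tau>)) has_real_derivative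
        (c1 - R * cos t) / (2 * u (t + \<tau>) ^ 5) - u (t + \<tau>) / 4) (at t)"
      using dv[of "t + \<tau>"] DERIV_shift[of "deriv u" _ t \<tau>] DERIV_deriv_iff_real_differentiable by metis
  qed (use R pos in auto)
  with c that show thesis by blast
qed

theorem corollary1p5:
  fixes c1 c2 c3 :: real and u :: "real \<Rightarrow> real"
  assumes "\<not> (c1 = 0 \<and> c2 = 0 \<and> c3 = 0)"
    and "positive_solution c1 c2 c3 u"
  shows "(- c1\<^sup>2 + c2\<^sup>2 + c3\<^sup>2 < 0 \<longrightarrow>
            (\<exists>D1 D2. D1 > 0 \<and> D2 > 0 \<and> (\<forall>\<theta>. D1 \<le> u \<theta> \<and> u \<theta> \<le> D2)))
       \<and> (- c1\<^sup>2 + c2\<^sup>2 + c3\<^sup>2 \<ge> 0 \<longrightarrow>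
            \<not> bounded (range u) \<and> (INF \<theta>. u \<theta>) = 0)
       \<and> (- c1\<^sup>2 + c2\<^sup>2 + c3\<^sup>2 = 0 \<longrightarrow>
            (\<exists>\<theta>0. c1 * cos \<theta>0 = c2 \<and> c1 * sin \<theta>0 = c3 \<and> u \<theta>0 = u (\<theta>0 + 2 * pi)))"
proof -
  obtain R \<tau> where c: "c2 = R * cos \<tau>" "c3 = R * sin \<tau>"
    and sol: "rotated_solution c1 R (\<lambda>t. u (t + \<tau>)) (\<lambda>t. deriv u (t + \<tau>))"
    by (rule rotate_positive_solution[OF assms(2)])
  interpret rotated_solution c1 R "\<lambda>t. u (t + \<tau>)" "\<lambda>t. deriv u (t + \<tau>)" by (rule sol)
  have "c2\<^sup>2 + c3\<^sup>2 = R\<^sup>2 * ((cos \<tau>)\<^sup>2 + (sin \<tau>)\<^sup>2)"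
    unfolding c by (simp only: power_mult_distrib distrib_left)
  then have D: "- c1\<^sup>2 + c2\<^sup>2 + c3\<^sup>2 = R\<^sup>2 - c1\<^sup>2" by simp
  have eq: "u t = u (t - \<tau> + \<tau>)" for t by simp
  have conclude: "\<not> bounded (range u) \<and> (INF \<theta>. u \<theta>) = 0"
    if "\<And>M. \<exists>t. M < u (t + \<tau>)" "\<And>m. 0 < m \<Longrightarrow> \<exists>t. u (t + \<tau>) < m"
  proof
    show "\<not> bounded (range u)"
      by (rule not_bounded_range_if) (use that(1) in blast)
    show "(INF \<theta>. u \<theta>) = 0"
      by (rule INF_eq_0_if_pos) (use that(2) u_pos eq in \<open>metis\<close>)+
  qed
  have degenerate: "c1 = R" "degenerate_solution R (\<lambda>t. u (t + \<tau>)) (\<lambda>t. deriv u (t + \<tau>))"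
    if "R\<^sup>2 = c1\<^sup>2"
  proof -
    show "c1 = R" using that coefficient_not_nonpositive by (auto simp: power2_eq_iff)
    then show "degenerate_solution R (\<lambda>t. u (t + \<tau>)) (\<lambda>t. deriv u (t + \<tau>))"
      using sol by (simp add: degenerate_solution_def)
  qed
  have "\<exists>D1 D2. D1 > 0 \<and> D2 > 0 \<and> (\<forall>\<theta>. D1 \<le> u \<theta> \<and> u \<theta> \<le> D2)" if "R\<^sup>2 - c1\<^sup>2 < 0"
    using bounded_away_if_definite that eq by (metis diff_less_0_iff_less)
  moreover have "\<not> bounded (range u) \<and> (INF \<theta>. u \<theta>) = 0" if "0 \<le> R\<^sup>2 - c1\<^sup>2"
  proof (cases "R\<^sup>2 = c1\<^sup>2")
    case True
    interpret deg: degenerate_solution R "\<lambda>t. u (t + \<tau>)" "\<lambda>t. deriv u (t + \<tau>)"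
      by (rule degenerate(2)[OF True])
    show ?thesis by (rule conclude) (rule deg.no_upper_bound deg.no_positive_lower_bound; assumption?)+
  next
    case False
    then have "\<bar>c1\<bar> < R"
      using that R_nonneg abs_le_square_iff[of R c1] by auto
    then have "oscillating_solution c1 R (\<lambda>t. u (t + \<tau>)) (\<lambda>t. deriv u (t + \<tau>)) (arccos (c1 / R))"
      using sol arccos_lt_bounded[of "c1 / R"]
      by (auto simp: oscillating_solution_def oscillating_solution_axioms_def field_simps)
    then interpret osc: oscillating_solution c1 R "\<lambda>t. u (t + \<tau>)" "\<lambda>t. deriv u (t + \<tau>)" "arccos (c1 / R)" .
    show ?thesis
      by (rule conclude) (use osc.unbounded_on_negative_arcs osc.no_positive_lower_bound in blast)+
  qed
  moreover have "\<exists>\<theta>0. c1 * cos \<theta>0 = c2 \<and> c1 * sin \<theta>0 = c3 \<and> u \<theta>0 = u (\<theta>0 + 2 * pi)"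
    if "R\<^sup>2 - c1\<^sup>2 = 0"
  proof -
    have e: "R\<^sup>2 = c1\<^sup>2" using that by simp
    interpret deg: degenerate_solution R "\<lambda>t. u (t + \<tau>)" "\<lambda>t. deriv u (t + \<tau>)"
      by (rule degenerate(2)[OF e])
    show ?thesis
      \<comment> \<open>The rotation angle is the witness: it is the node at 0, and
        \<open>c1 = R\<close> gives the two trigonometric equations.\<close>
      using deg.node_value[of 1] degenerate(1)[OF e] c by (intro exI[of _ \<tau>]) (simp add: add.commute)
  qed
  ultimately show ?thesis unfolding D by blast
qed

end
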